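(* Let $k>0$ be a real number. Then $\mathbb{H}_k$ satisfies the hyperbolic property: for each $h$-line $L$ of $\mathbb{H}_k$ and each point $P\in\mathcal{P}$ with $P\notin L$, there exist exactly two $h$-lines through $P$ that are parallel to $L$.
   Context: Let $\mathcal{P}=\{(x,y)\mid x,y\in\mathbb{R},\ y>0\}$ be the open upper half-plane. Fix a real constant $k>0$. For $p\in\mathbb{R}$ let $L_p=\{(p,y)\in\mathcal{P}\}$ (the half-line $x=p$, $y>0$). For $a,c\in\mathbb{R}$ with $a>0$ let $L_{kac}=\{(x,y)\in\mathcal{P}\mid (x-c)^2+k^2y^2=a^2\}$ (an upper half-ellipse centered at $(c,0)$). Let $\mathcal{L}=\{L_p\mid p\in\mathbb{R}\}\cup\{L_{kac}\mid a,c\in\mathbb{R},\ a>0\}$ (with $k$ fixed). The elements of $\mathcal{L}$ are called hyperbolic lines, or $h$-lines, and the system $\mathbb{H}_k=\{\mathcal{P},\mathcal{L}\}$ is called the generalized Poincaré half-plane determined by $k$. Parallelism here does not mean disjointness; it is defined as follows. Any two distinct $h$-lines $L_p,L_q$ ($p\neq q$) are parallel. Any other two different $h$-lines are parallel if and only if their Euclidean extensions meet on the $x$-axis. (The Euclidean extension of $L_p$ is the line $x=p$, which meets the $x$-axis at $(p,0)$; that of $L_{kac}$ is the ellipse $(x-c)^2+k^2y^2=a^2$, which meets the $x$-axis at $(c-a,0)$ and $(c+a,0)$.) Explicitly: $L_p$ and $L_{kac}$ are parallel iff $p\in\{c-a,c+a\}$; and two different $h$-lines $L_{kac}$, $L_{ka'c'}$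 are parallel iff $\{c-a,c+a\}\cap\{c'-a',c'+a'\}\neq\varnothing$. *)

theory Defs
  imports Complex_Main
begin

definition half_plane :: "(real \<times> real) set" where
  "half_plane = {(x, y). y > 0}"

definition vline :: "real \<Rightarrow> (real \<times> real) set" where
  "vline p = {(x, y). (x, y) \<in> half_plane \<and> x = p}"

definition half_ellipse :: "real \<Rightarrow> real \<Rightarrow> real \<Rightarrow> (real \<times> real) set" where
  "half_ellipse k a c = {(x, y). (x, y) \<in> half_plane \<and> (x - c)\<^sup>2 + k\<^sup>2 * y\<^sup>2 = a\<^sup>2}"

definition h_lines :: "real \<Rightarrow> (real \<times> real) set set" where
  "h_lines k = {vline p | p. True} \<union> {half_ellipse k a c | a c. a > 0}"

(* For k > 0 the parameters p, respectively (a, c), are determined by the h-line, so every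
   h-line has exactly one extension. *)
inductive euclidean_extension :: "real \<Rightarrow> (real \<times> real) set \<Rightarrow> (real \<times> real) set \<Rightarrow> bool"
  for k :: real where
  vertical: "euclidean_extension k (vline p) {(x, y). x = p}"
| ellipse: "a > 0 \<Longrightarrow>
    euclidean_extension k (half_ellipse k a c) {(x, y). (x - c)\<^sup>2 + k\<^sup>2 * y\<^sup>2 = a\<^sup>2}"

(* Parallelism is not disjointness: two distinct vertical h-lines are always parallel, and any
   other two distinct h-lines are parallel iff their extensions share a point of the x-axis. *)
definition h_parallel :: "real \<Rightarrow> (real \<times> real) set \<Rightarrow> (real \<times> real) set \<Rightarrow> bool" where
  "h_parallel k L M \<longleftrightarrow> L \<in> h_lines k \<and> M \<in> h_lines k \<and> L \<noteq> M \<and>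
     ((\<exists>p q. L = vline p \<and> M = vline q) \<or>
      (\<exists>E F x. euclidean_extension k L E \<and> euclidean_extension k M F \<and> (x, 0) \<in> E \<inter> F))"

end

theory Submission
  imports Defs
begin

text \<open>
  The idea is to complete the \<open>x\<close>-axis by one point at infinity and to read parallelism off this
  boundary. Every \<open>h\<close>-line has exactly two ideal points: a vertical line has its foot and the point
  at infinity, a half-ellipse has its two feet. In these terms the two clauses in the definition
  of parallelism become one: distinct \<open>h\<close>-lines are parallel iff they share an ideal point, since two
  vertical lines share the point at infinity (\<open>h_parallel_iff_common_ideal_point\<close>).

  Two incidence facts then give the result. An \<open>h\<close>-line is determined by its pair of ideal points
  (\<open>h_line_eq_if_ideal_points_eq\<close>), and exactly one \<open>h\<close>-line joins a given point of the half-plane to a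
  given ideal point (\<open>ex1_h_line_through_point_and_ideal_point\<close>). Hence the parallels to \<open>L\<close>
  through \<open>P\<close> are the lines joining \<open>P\<close> to the two ideal points of \<open>L\<close>. These two lines are
  distinct, for a line with both ideal points of \<open>L\<close> would be \<open>L\<close>, which misses \<open>P\<close>.
\<close>

section \<open>The parameters of an h-line\<close>

text \<open>The shadow of an \<open>h\<close>-line on the axis, a point or an open interval, recovers its parameters
  although the line is given only as a set of points. This makes the Euclidean extension of a line,
  and hence its set of ideal points, computable from any one description of the line.\<close>

lemma fst_image_vline: "fst ` vline p = {p}"
proof -
  have "(p, 1) \<in> vline p"
    by (simp add: vline_def half_plane_def)
  then show ?thesis
    by (force simp: vline_def)
qed

lemma fst_image_half_ellipse:
  assumes "k > 0" "a > 0"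
  shows "fst ` half_ellipse k a c = {c - a<..<c + a}"
proof (intro equalityI subsetI)
  fix x assume "x \<in> fst ` half_ellipse k a c"
  then obtain y where y: "y > 0" "(x - c)\<^sup>2 + k\<^sup>2 * y\<^sup>2 = a\<^sup>2"
    by (auto simp: half_ellipse_def half_plane_def)
  have "k\<^sup>2 * y\<^sup>2 > 0"
    using assms y by simp
  then have "(x - c)\<^sup>2 < a\<^sup>2"
    using y(2) by linarith
  then have "\<bar>x - c\<bar> < a"
    using assms by (metis less_imp_le power2_abs power2_less_imp_less)
  then show "x \<in> {c - a<..<c + a}"
    by auto
next
  fix x assume "x \<in> {c - a<..<c + a}"
  then have "\<bar>x - c\<bar> < \<bar>a\<bar>"
    by auto
  then have pos: "a\<^sup>2 - (x - c)\<^sup>2 > 0"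
    by (metis diff_gt_0_iff_gt abs_ge_zero power2_abs power_strict_mono zero_less_numeral)
  define y where "y = sqrt (a\<^sup>2 - (x - c)\<^sup>2) / k"
  have "y > 0" "k\<^sup>2 * y\<^sup>2 = a\<^sup>2 - (x - c)\<^sup>2"
    using pos assms by (simp_all add: y_def power_divide)
  then have "(x, y) \<in> half_ellipse k a c"
    by (simp add: half_ellipse_def half_plane_def)
  then show "x \<in> fst ` half_ellipse k a c"
    by force
qed

lemma vline_eq_iff: "vline p = vline q \<longleftrightarrow> p = q"
  by (metis fst_image_vline singleton_inject)

lemma half_ellipse_eq_iff:
  assumes "k > 0" "a > 0" "b > 0"
  shows "half_ellipse k a c = half_ellipse k b d \<longleftrightarrow> a = b \<and> c = d"
proof
  assume "half_ellipse k a c = half_ellipse k b d"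
  then have "{c - a<..<c + a} = {d - b<..<d + b}"
    using assms by (metis fst_image_half_ellipse)
  then have "c - a = d - b \<and> c + a = d + b"
    using assms by (auto simp: set_eq_subset greaterThanLessThan_subseteq_greaterThanLessThan)
  then show "a = b \<and> c = d"
    by linarith
qed simp

lemma vline_neq_half_ellipse:
  assumes "k > 0" "a > 0"
  shows "vline p \<noteq> half_ellipse k a c"
proof
  assume "vline p = half_ellipse k a c"
  then have "{c - a<..<c + a} = {p}"
    using assms by (metis fst_image_half_ellipse fst_image_vline)
  moreover have "infinite {c - a<..<c + a}"
    using assms by (simp add: infinite_Ioo)
  ultimately show False
    by simp
qed

section \<open>Ideal points\<close>

text \<open>The value \<^term>\<open>None\<close> stands for the point at infinity, and \<^term>\<open>Some x\<close> for
  the point \<open>(x, 0)\<close> of the axis.\<close>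

definition ideal_points :: "real \<Rightarrow> (real \<times> real) set \<Rightarrow> real option set" where
  "ideal_points k L =
     {e. case e of None \<Rightarrow> \<exists>p. L = vline p
         | Some x \<Rightarrow> \<exists>E. euclidean_extension k L E \<and> (x, 0) \<in> E}"

lemma ideal_points_vline:
  assumes "k > 0"
  shows "ideal_points k (vline p) = {None, Some p}"
proof -
  have "(\<exists>E. euclidean_extension k (vline p) E \<and> (x, 0) \<in> E) \<longleftrightarrow> x = p" for x
    using assms vline_neq_half_ellipse[of k]
    by (auto simp: euclidean_extension.simps vline_eq_iff)
  then show ?thesis
    by (auto simp: ideal_points_def split: option.splits)
qed

lemma ideal_points_half_ellipse:
  assumes "k > 0" "a > 0"
  shows "ideal_points k (half_ellipse k a c) = {Some (c - a), Some (c + a)}"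
proof -
  have foot: "(x - c)\<^sup>2 = a\<^sup>2 \<longleftrightarrow> x = c - a \<or> x = c + a" for x
    unfolding power2_eq_iff by auto
  have "(\<exists>E. euclidean_extension k (half_ellipse k a c) E \<and> (x, 0) \<in> E) \<longleftrightarrow> x = c - a \<or> x = c + a"
    for x
  proof
    assume "\<exists>E. euclidean_extension k (half_ellipse k a c) E \<and> (x, 0) \<in> E"
    then obtain E where "euclidean_extension k (half_ellipse k a c) E" "(x, 0) \<in> E"
      by blast
    then show "x = c - a \<or> x = c + a"
      using vline_neq_half_ellipse[OF assms, of _ c] half_ellipse_eq_iff[OF assms]
      by cases (auto simp: foot)
  next
    assume "x = c - a \<or> x = c + a"
    then show "\<exists>E. euclidean_extension k (half_ellipse k a c) E \<and> (x, 0) \<in> E"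
      using euclidean_extension.ellipse[OF assms(2), of k c] by (auto simp: foot)
  qed
  moreover have "\<nexists>p. half_ellipse k a c = vline p"
    using vline_neq_half_ellipse[OF assms] by metis
  ultimately show ?thesis
    by (auto simp: ideal_points_def split: option.splits)
qed

lemma h_line_cases:
  assumes "M \<in> h_lines k"
  obtains p where "M = vline p"
  | a c where "a > 0" "M = half_ellipse k a c"
  using assms by (auto simp: h_lines_def)

lemma card_ideal_points:
  assumes "k > 0" "L \<in> h_lines k"
  shows "card (ideal_points k L) = 2"
  using assms(2)
  by (cases rule: h_line_cases) (auto simp: assms(1) ideal_points_vline ideal_points_half_ellipse)

lemma h_line_eq_if_ideal_points_eq:
  assumes "k > 0" "L \<in> h_lines k" "M \<in> h_lines k"
    and eq: "ideal_points k L = ideal_points k M"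
  shows "L = M"
  using assms(2)
proof (cases rule: h_line_cases)
  case L: (1 p)
  show ?thesis
    using assms(3)
    by (cases rule: h_line_cases)
      (use eq L assms(1) in \<open>auto simp: ideal_points_vline ideal_points_half_ellipse doubleton_eq_iff\<close>)
next
  case L: (2 a c)
  show ?thesis
    using assms(3)
  proof (cases rule: h_line_cases)
    case (1 q)
    then show ?thesis
      using eq L assms(1)
      by (auto simp: ideal_points_vline ideal_points_half_ellipse doubleton_eq_iff)
  next
    case M: (2 b d)
    have "c - a = d - b \<and> c + a = d + b"
      using eq L M assms(1) by (auto simp: ideal_points_half_ellipse doubleton_eq_iff)
    then have "a = b \<and> c = d"
      by linarith
    then show ?thesis
      using L M by simp
  qed
qed

lemma h_parallel_iff_common_ideal_point:
  "h_parallel k L M \<longleftrightarrow>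
     L \<in> h_lines k \<and> M \<in> h_lines k \<and> L \<noteq> M \<and> ideal_points k L \<inter> ideal_points k M \<noteq> {}"
proof -
  have "ideal_points k L \<inter> ideal_points k M \<noteq> {} \<longleftrightarrow>
      (\<exists>e. e \<in> ideal_points k L \<and> e \<in> ideal_points k M)"
    by blast
  also have "\<dots> \<longleftrightarrow>
      (None \<in> ideal_points k L \<and> None \<in> ideal_points k M) \<or>
      (\<exists>x. Some x \<in> ideal_points k L \<and> Some x \<in> ideal_points k M)"
    by (metis option.exhaust)
  also have "\<dots> \<longleftrightarrow>
      (\<exists>p q. L = vline p \<and> M = vline q) \<or>
      (\<exists>E F x. euclidean_extension k L E \<and> euclidean_extension k M F \<and> (x, 0) \<in> E \<inter> F)"
    unfolding ideal_points_def by auto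
  finally show ?thesis
    unfolding h_parallel_def by blast
qed

section \<open>Joining a point to an ideal point\<close>

text \<open>A half-ellipse with foot \<open>z\<close> passes through \<open>(x, y)\<close> iff its centre \<open>c\<close> is equidistant from
  \<open>z\<close> and \<open>(x, y)\<close> in the metric that scales heights by \<open>k\<close>. The squares of \<open>c\<close> cancel, so the
  equation is linear in \<open>c\<close> with leading coefficient \<open>2 * (x - z)\<close>: it has one solution for \<open>z \<noteq> x\<close>,
  and none for \<open>z = x\<close>, where the vertical line takes over.\<close>

lemma ex1_h_line_through_point_and_ideal_point:
  assumes "k > 0" "P \<in> half_plane"
  shows "\<exists>!M. M \<in> h_lines k \<and> P \<in> M \<and> e \<in> ideal_points k M"
proof -
  obtain x y where P: "P = (x, y)" "y > 0"
    using assms(2) by (auto simp: half_plane_def)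
  have pos: "k\<^sup>2 * y\<^sup>2 > 0"
    using assms P by simp
  have on_vline: "P \<in> vline p \<longleftrightarrow> p = x" for p
    using P by (auto simp: vline_def half_plane_def)
  have on_ellipse: "P \<in> half_ellipse k a c \<longleftrightarrow> (x - c)\<^sup>2 + k\<^sup>2 * y\<^sup>2 = a\<^sup>2" for a c
    using P by (simp add: half_ellipse_def half_plane_def)
  have foot: "Some z \<in> ideal_points k (half_ellipse k a c) \<longleftrightarrow> a = \<bar>z - c\<bar>" if "a > 0" for z a c
    using that assms(1) by (auto simp: ideal_points_half_ellipse)
  have vline_mem: "vline p \<in> h_lines k" for p
    by (auto simp: h_lines_def)
  show ?thesis
  proof (cases "e = None \<or> e = Some x")
    case True
    show ?thesis
    proof (intro ex1I conjI)
      show "e \<in> ideal_points k (vline x)"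
        using True assms(1) by (auto simp: ideal_points_vline)
    next
      fix M assume M: "M \<in> h_lines k \<and> P \<in> M \<and> e \<in> ideal_points k M"
      then have "M \<in> h_lines k" ..
      then show "M = vline x"
      proof (cases rule: h_line_cases)
        case (1 p)
        then show ?thesis
          using M on_vline by auto
      next
        case (2 a c)
        then have "a = \<bar>x - c\<bar>"
          using M True foot assms(1) by (auto simp: ideal_points_half_ellipse)
        then show ?thesis
          using M 2 pos on_ellipse[of a c] by auto
      qed
    qed (use vline_mem on_vline in auto)
  next
    case False
    then obtain z where z: "e = Some z" "z \<noteq> x"
      by (cases e) auto
    define c where "c = (x\<^sup>2 + k\<^sup>2 * y\<^sup>2 - z\<^sup>2) / (2 * (x - z))"
    have centre: "(x - d)\<^sup>2 + k\<^sup>2 * y\<^sup>2 = (z - d)\<^sup>2 \<longleftrightarrow> d = c" for d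
      using z(2) unfolding c_def
      by (simp add: eq_divide_eq power2_eq_square algebra_simps) linarith
    have "z \<noteq> c"
      using centre[of c] pos by (auto simp: add_nonneg_pos order_less_imp_not_eq2)
    then have a: "\<bar>z - c\<bar> > 0"
      by simp
    show ?thesis
    proof (intro ex1I conjI)
      show "half_ellipse k \<bar>z - c\<bar> c \<in> h_lines k"
        using a by (auto simp: h_lines_def)
      show "P \<in> half_ellipse k \<bar>z - c\<bar> c"
        using centre on_ellipse by simp
      show "e \<in> ideal_points k (half_ellipse k \<bar>z - c\<bar> c)"
        using foot[OF a] z by simp
    next
      fix M assume M: "M \<in> h_lines k \<and> P \<in> M \<and> e \<in> ideal_points k M"
      then have "M \<in> h_lines k" ..
      then show "M = half_ellipse k \<bar>z - c\<bar> c"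
      proof (cases rule: h_line_cases)
        case (1 p)
        then show ?thesis
          using M z on_vline assms(1) by (auto simp: ideal_points_vline)
      next
        case (2 b d)
        then have "b = \<bar>z - d\<bar>"
          using M z foot by simp
        moreover from this have "d = c"
          using M 2 on_ellipse centre by simp
        ultimately show ?thesis
          using 2 by simp
      qed
    qed
  qed
qed

section \<open>The hyperbolic property\<close>

theorem proposition2p2:
  fixes k :: real
  assumes "k > 0"
  shows "\<forall>L \<in> h_lines k. \<forall>P \<in> half_plane. P \<notin> L \<longrightarrow>
           card {M \<in> h_lines k. P \<in> M \<and> h_parallel k M L} = 2"
proof (intro ballI impI)
  fix L P assume L: "L \<in> h_lines k" and P: "P \<in> half_plane" and "P \<notin> L"
  define join where "join e = (THE M. M \<in> h_lines k \<and> P \<in> M \<and> e \<in> ideal_points k M)" for e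
  note ex1 = ex1_h_line_through_point_and_ideal_point[OF assms P]
  have join: "join e \<in> h_lines k" "P \<in> join e" "e \<in> ideal_points k (join e)" for e
    using theI'[OF ex1[of e]] by (simp_all add: join_def)
  have join_unique: "M = join e" if "M \<in> h_lines k" "P \<in> M" "e \<in> ideal_points k M" for M e
    using ex1[of e] that join by blast
  have "{M \<in> h_lines k. P \<in> M \<and> h_parallel k M L} = join ` ideal_points k L"
    using L \<open>P \<notin> L\<close> join join_unique
    unfolding h_parallel_iff_common_ideal_point by fastforce
  moreover have "inj_on join (ideal_points k L)"
  proof (rule inj_onI, rule ccontr)
    fix e f assume e: "e \<in> ideal_points k L" and f: "f \<in> ideal_points k L"
      and eq: "join e = join f" and "e \<noteq> f"
    have both: "ideal_points k N = {e, f}"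
      if "N \<in> h_lines k" "e \<in> ideal_points k N" "f \<in> ideal_points k N" for N
      using card_ideal_points[OF assms that(1)] that(2,3) \<open>e \<noteq> f\<close>
      by (auto simp: card_2_iff)
    have "ideal_points k (join e) = {e, f}"
      using both[OF join(1,3)] join(3)[of f] eq by simp
    moreover have "ideal_points k L = {e, f}"
      using both[OF L e f] .
    ultimately have "join e = L"
      using h_line_eq_if_ideal_points_eq[OF assms join(1) L] by simp
    then show False
      using join(2) \<open>P \<notin> L\<close> by blast
  qed
  ultimately show "card {M \<in> h_lines k. P \<in> M \<and> h_parallel k M L} = 2"
    using card_ideal_points[OF assms L] by (simp add: card_image)
qed

end
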